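(* Let $p$ be a prime, $p>3$, and let $q = p^h$ with $h \in \mathbb{N}$. Then there exists a $B_2[2]$ sequence of non-zero polynomials in $\mathbb{F}_q[t]$ which is an asymptotic basis of order $3$.
   Context: $\mathbb{F}_q$ is the finite field with $q$ elements. A sequence of non-zero polynomials $\omega$ in $\mathbb{F}_q[t]$ is regarded as a set of polynomials. It is a $B_2[g]$ sequence if every $n \in \mathbb{F}_q[t]$ has at most $g$ representations of the form $n = a + a'$ with $a, a' \in \omega$, where representations differing only in the order of the summands are identified (and $a=a'$ is allowed). It is an asymptotic basis of order $g$ if every $n \in \mathbb{F}_q[t]$ with $\deg n$ sufficiently large can be expressed as a sum of $g$ (not necessarily distinct) elements of $\omega$. *)

theory Defs
  imports
    "HOL-Library.Cardinality"
    "HOL-Library.Multiset"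
    "HOL-Computational_Algebra.Polynomial"
    "HOL-Computational_Algebra.Primes"
begin

text \<open>
  A sequence of polynomials is treated as a set. A representation \<open>n = a + a'\<close> is recorded as
  the multiset of its summands, so that the order of the summands is irrelevant and
  \<open>a = a'\<close> is allowed.
\<close>

definition sum2_representations :: "'a::comm_monoid_add poly set \<Rightarrow> 'a poly \<Rightarrow> 'a poly multiset set"
  where "sum2_representations \<omega> n = {{#a, a'#} | a a'. a \<in> \<omega> \<and> a' \<in> \<omega> \<and> n = a + a'}"

text \<open>
  Finiteness is stated separately because \<open>card\<close> is \<open>0\<close> on infinite sets.
\<close>

definition B2_sequence :: "nat \<Rightarrow> 'a::comm_monoid_add poly set \<Rightarrow> bool"
  where "B2_sequence g \<omega> \<longleftrightarrow>
    (\<forall>n. finite (sum2_representations \<omega> n) \<and> card (sum2_representations \<omega> n) \<le> g)"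

definition asymptotic_basis :: "nat \<Rightarrow> 'a::comm_monoid_add poly set \<Rightarrow> bool"
  where "asymptotic_basis g \<omega> \<longleftrightarrow>
    (\<exists>N. \<forall>n. degree n \<ge> N \<longrightarrow>
      (\<exists>as. length as = g \<and> set as \<subseteq> \<omega> \<and> n = sum_list as))"

end

theory Submission
  imports "HOL-Number_Theory.Residues" "HOL-Library.Countable_Set" "HOL-Library.Nat_Bijection" Defs
begin

text \<open>
  In \<open>F[t]\<close> the summands of \<open>n\<close> may have much larger degree than \<open>n\<close>, since leading terms can
  cancel. This makes an explicit construction possible. Attach to every polynomial \<open>n\<close> its own
  exponent \<open>f n > deg n\<close>, with \<open>f\<close> injective, and let \<open>\<omega>\<close> consist of all the powers \<open>t ^ f n\<close>
  together with all their complements \<open>n - t ^ f n\<close>.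

  The identity \<open>n = t ^ f n + (n - t ^ f n)\<close> makes \<open>\<omega>\<close> a basis of order 2, and
  subtracting a fixed element of \<open>\<omega>\<close> first makes it a basis of order 3. Conversely, consider a
  representation \<open>s = x + y\<close>. If the leading terms of \<open>x\<close> and \<open>y\<close> cancel, then \<open>x\<close> and \<open>y\<close> have the
  same degree \<open>f m\<close> and opposite signs, so they are \<open>t ^ f m\<close> and \<open>m - t ^ f m\<close>, which forces
  \<open>m = s\<close>: there is one such representation (\<open>cancelling_representation\<close>). If they do not cancel,
  the leading term of \<open>s\<close> has degree \<open>max (deg x) (deg y)\<close> and coefficient \<open>1\<close> or \<open>2\<close> when
  the dominant summand is a power, \<open>-1\<close> or \<open>-2\<close> when it is a complement. In characteristic
  different from 2 and 3 these cases are disjoint, so \<open>s\<close> determines its dominant summand and hence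
  the other one (\<open>noncancelling_unique\<close>). Thus \<open>s\<close> has at most two representations.
\<close>

text \<open>
  The non-vanishing coefficient is \<open>1\<close> or \<open>2\<close> if \<open>x\<close> has leading coefficient \<open>1\<close>, and \<open>-1\<close> or \<open>-2\<close>
  if it has leading coefficient \<open>-1\<close>. An overlap would make one of \<open>2\<close>, \<open>3\<close>, \<open>4\<close> vanish, so
  the degree and the leading coefficient of \<open>x\<close> can be read off from \<open>x + y\<close>.
\<close>

lemma noncancelling_unique:
  fixes x y z w :: "'a::field poly"
  assumes char: "(2::'a) \<noteq> 0" "(3::'a) \<noteq> 0"
    and sign: "\<And>u. u \<in> \<omega> \<Longrightarrow> lead_coeff u = 1 \<or> lead_coeff u = -1"
    and determined: "\<And>u v. u \<in> \<omega> \<Longrightarrow> v \<in> \<omega> \<Longrightarrow> degree u = degree v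
      \<Longrightarrow> lead_coeff u = lead_coeff v \<Longrightarrow> u = v"
    and mem: "x \<in> \<omega>" "y \<in> \<omega>" "z \<in> \<omega>" "w \<in> \<omega>"
    and dominant: "degree y \<le> degree x" "degree w \<le> degree z"
    and noncancelling: "coeff (x + y) (degree x) \<noteq> 0" "coeff (z + w) (degree z) \<noteq> 0"
    and sums: "x + y = z + w"
  shows "x = z \<and> y = w"
proof -
  have "degree (x + y) = degree x" "degree (z + w) = degree z"
    using noncancelling dominant
    by (meson degree_add_le le_degree order.antisym order_refl)+
  then have deg: "degree x = degree z"
    using sums by simp
  have lower: "coeff u d = 0 \<or> coeff u d = lead_coeff u" if "degree u \<le> d" for u :: "'a poly" and d
    using that by (cases "degree u = d") (auto intro: coeff_eq_0)
  have y: "coeff y (degree x) \<in> {0, 1, -1}" and w: "coeff w (degree x) \<in> {0, 1, -1}"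
    using lower[OF dominant(1)] lower[OF dominant(2)] sign[OF mem(2)] sign[OF mem(4)] deg by auto
  have top: "lead_coeff x + coeff y (degree x) = lead_coeff z + coeff w (degree x)"
    using arg_cong[OF sums, of "\<lambda>p. coeff p (degree x)"] deg by simp
  have nz: "lead_coeff x + coeff y (degree x) \<noteq> 0" "lead_coeff z + coeff w (degree x) \<noteq> 0"
    using noncancelling deg by simp_all
  have "(4::'a) \<noteq> 0"
    using char(1) mult_eq_0_iff[of "2::'a" 2] by simp
  then have disjoint: "(1::'a) \<noteq> -1" "(1::'a) \<noteq> -2" "(2::'a) \<noteq> -1" "(2::'a) \<noteq> -2"
    using char by (simp_all add: eq_neg_iff_add_eq_0)
  have "lead_coeff x = lead_coeff z"
    using sign[OF mem(1)] sign[OF mem(3)] y w top nz disjoint disjoint[symmetric] by auto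
  then have "x = z"
    using determined mem(1,3) deg by blast
  then show ?thesis
    using sums by simp
qed

definition powers_and_complements :: "('a::field poly \<Rightarrow> nat) \<Rightarrow> 'a poly set"
  where "powers_and_complements f =
    range (\<lambda>n. monom 1 (f n)) \<union> range (\<lambda>n. n - monom 1 (f n))"

lemma degree_complement:
  fixes n :: "'a::field poly"
  assumes "degree n < k"
  shows "degree (n - monom 1 k) = k" "lead_coeff (n - monom 1 k) = -1"
proof -
  show deg: "degree (n - monom 1 k) = k"
    using degree_add_eq_right[of n "- monom 1 k"] assms by (simp add: degree_monom_eq)
  show "lead_coeff (n - monom 1 k) = -1"
    unfolding deg using assms by (simp add: coeff_eq_0)
qed

lemma powers_and_complements_cases:
  assumes "u \<in> powers_and_complements f" and "\<And>n. degree n < f n"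
  obtains n where "u = monom 1 (f n)" "degree u = f n" "lead_coeff u = 1"
  | n where "u = n - monom 1 (f n)" "degree u = f n" "lead_coeff u = -1"
proof -
  from assms(1) consider n where "u = monom 1 (f n)" | n where "u = n - monom 1 (f n)"
    unfolding powers_and_complements_def by blast
  then show ?thesis
  proof cases
    case (1 n)
    then show ?thesis
      by (intro that(1)) (simp_all add: degree_monom_eq)
  next
    case (2 n)
    then show ?thesis
      using degree_complement[OF assms(2)] by (intro that(2)) simp_all
  qed
qed

lemma powers_and_complements_nonzero:
  assumes "\<And>n. degree n < f n"
  shows "0 \<notin> powers_and_complements f"
  by (auto elim: powers_and_complements_cases[OF _ assms])

text \<open>
  Cancellation needs equal degrees and opposite signs. Since \<open>f\<close> is injective, equal degrees mean
  that both summands belong to the same \<open>m\<close>, and opposite signs that one is the power and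
  the other its complement. Their sum is then \<open>m\<close> itself.
\<close>

lemma cancelling_representation:
  fixes x y :: "'a::field poly"
  assumes char: "(2::'a) \<noteq> 0" and inj: "inj f" and high: "\<And>n. degree n < f n"
    and mem: "x \<in> powers_and_complements f" "y \<in> powers_and_complements f"
    and dominant: "degree y \<le> degree x"
    and cancelling: "coeff (x + y) (degree x) = 0"
  shows "{#x, y#} = {#monom 1 (f (x + y)), x + y - monom 1 (f (x + y))#}"
proof -
  have lead: "lead_coeff x \<noteq> 0"
    using mem(1) powers_and_complements_nonzero[OF high] by auto
  have deg: "degree y = degree x"
    using dominant cancelling lead coeff_eq_0[of y "degree x"] by fastforce
  then have opposite: "lead_coeff x + lead_coeff y = 0"
    using cancelling by simp
  from mem(1) high show ?thesis
  proof (cases rule: powers_and_complements_cases)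
    case x: (1 m)
    from mem(2) high show ?thesis
    proof (cases rule: powers_and_complements_cases)
      case (1 n)
      then show ?thesis using x opposite char by simp
    next
      case (2 n)
      then have "n = m" using x deg inj by (simp add: inj_eq)
      then show ?thesis using 2 x by simp
    qed
  next
    case x: (2 m)
    from mem(2) high show ?thesis
    proof (cases rule: powers_and_complements_cases)
      case (1 n)
      then have "n = m" using x deg inj by (simp add: inj_eq)
      then show ?thesis using 1 x by (simp add: add_mset_commute)
    next
      case (2 n)
      then show ?thesis using x opposite char by simp
    qed
  qed
qed

text \<open>
  One representation of \<open>s\<close> is accounted for by cancellation and at most one by its absence.
\<close>

lemma powers_and_complements_B2:
  fixes f :: "'a::field poly \<Rightarrow> nat"
  assumes char: "(2::'a) \<noteq> 0" "(3::'a) \<noteq> 0" and inj: "inj f" and high: "\<And>n. degree n < f n"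
  shows "B2_sequence 2 (powers_and_complements f)"
  unfolding B2_sequence_def
proof
  fix s :: "'a poly"
  let ?\<omega> = "powers_and_complements f"
  define N where "N = {{#x, y#} | x y. x \<in> ?\<omega> \<and> y \<in> ?\<omega> \<and> s = x + y
    \<and> degree y \<le> degree x \<and> coeff (x + y) (degree x) \<noteq> 0}"
  have sign: "lead_coeff u = 1 \<or> lead_coeff u = -1" if "u \<in> ?\<omega>" for u
    using that high by (cases rule: powers_and_complements_cases) simp_all
  have determined: "u = v"
    if u: "u \<in> ?\<omega>" and v: "v \<in> ?\<omega>" and same: "degree u = degree v" "lead_coeff u = lead_coeff v"
    for u v
  proof -
    have "(1::'a) \<noteq> -1"
      using char(1) by (simp add: eq_neg_iff_add_eq_0)
    note signs = this this[symmetric]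
    from u high show ?thesis
    proof (cases rule: powers_and_complements_cases)
      case 1
      from v high show ?thesis
        by (cases rule: powers_and_complements_cases) (use 1 same signs in simp_all)
    next
      case (2 m)
      from v high show ?thesis
        by (cases rule: powers_and_complements_cases) (use 2 same signs inj in \<open>simp_all add: inj_eq\<close>)
    qed
  qed
  have "A = B" if "A \<in> N" "B \<in> N" for A B
  proof -
    from that(1) obtain x y where xy: "A = {#x, y#}" "x \<in> ?\<omega>" "y \<in> ?\<omega>" "s = x + y"
      "degree y \<le> degree x" "coeff (x + y) (degree x) \<noteq> 0"
      unfolding N_def by blast
    from that(2) obtain z w where zw: "B = {#z, w#}" "z \<in> ?\<omega>" "w \<in> ?\<omega>" "s = z + w"
      "degree w \<le> degree z" "coeff (z + w) (degree z) \<noteq> 0"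
      unfolding N_def by blast
    have "x + y = z + w"
      using xy(4) zw(4) by (rule subst)
    with noncancelling_unique[OF char sign determined xy(2,3) zw(2,3) xy(5) zw(5) xy(6) zw(6)]
    show ?thesis
      using xy(1) zw(1) by blast
  qed
  then obtain B where "N \<subseteq> {B}"
    by blast
  moreover have "sum2_representations ?\<omega> s \<subseteq> insert {#monom 1 (f s), s - monom 1 (f s)#} N"
  proof
    fix A assume "A \<in> sum2_representations ?\<omega> s"
    then obtain a b where ab: "A = {#a, b#}" "a \<in> ?\<omega>" "b \<in> ?\<omega>" "s = a + b"
      unfolding sum2_representations_def by blast
    obtain x y where xy: "A = {#x, y#}" "x \<in> ?\<omega>" "y \<in> ?\<omega>" "s = x + y" "degree y \<le> degree x"
    proof (cases "degree b \<le> degree a")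
      case True
      then show ?thesis
        using that ab by blast
    next
      case False
      then show ?thesis
        using that[of b a] ab by (simp add: add.commute add_mset_commute)
    qed
    show "A \<in> insert {#monom 1 (f s), s - monom 1 (f s)#} N"
    proof (cases "coeff (x + y) (degree x) = 0")
      case True
      then show ?thesis
        using cancelling_representation[OF char(1) inj high xy(2,3,5)] xy(1,4) by simp
    next
      case False
      then show ?thesis
        using xy unfolding N_def by blast
    qed
  qed
  ultimately have sub: "sum2_representations ?\<omega> s \<subseteq> {{#monom 1 (f s), s - monom 1 (f s)#}, B}"
    by blast
  have "card {{#monom 1 (f s), s - monom 1 (f s)#}, B} \<le> 2"
    by (simp add: card_insert_if)
  then show "finite (sum2_representations ?\<omega> s) \<and> card (sum2_representations ?\<omega> s) \<le> 2"
    using finite_subset[OF sub] card_mono[OF _ sub] by (meson finite.intros order.trans)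
qed

lemma powers_and_complements_basis: "asymptotic_basis 3 (powers_and_complements f)"
  unfolding asymptotic_basis_def
proof (intro exI allI impI)
  fix n :: "'a poly"
  \<comment> \<open>Any fixed element of the set serves as one summand; the pair attached to \<open>n - c\<close> supplies
    the other two.\<close>
  define c :: "'a poly" where "c = monom 1 (f 0)"
  let ?as = "[c, monom 1 (f (n - c)), (n - c) - monom 1 (f (n - c))]"
  show "length ?as = 3 \<and> set ?as \<subseteq> powers_and_complements f \<and> n = sum_list ?as"
    by (auto simp: powers_and_complements_def c_def)
qed

lemma ex_inj_above_degree:
  "\<exists>f :: 'a::{field,finite} poly \<Rightarrow> nat. inj f \<and> (\<forall>n. degree n < f n)"
proof -
  have "countable (range (coeffs :: 'a poly \<Rightarrow> 'a list))"
    by (rule countable_subset[of _ "lists UNIV"]) (auto intro: countable_lists countable_finite)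
  then have "countable (UNIV :: 'a poly set)"
    by (rule countable_image_inj_on) (simp add: inj_on_def coeffs_eq_iff)
  then obtain g :: "'a poly \<Rightarrow> nat" where g: "inj g"
    by (rule countableE)
  \<comment> \<open>The pairing function dominates its second argument, and the successor makes this strict.\<close>
  define f where "f n = Suc (prod_encode (g n, degree n))" for n
  have "inj f"
    using g by (auto simp: f_def inj_def)
  moreover have "degree n < f n" for n
    by (simp add: f_def le_prod_encode_2 less_Suc_eq_le)
  ultimately show ?thesis
    by blast
qed

text \<open>
  The characteristic divides the order of the field, so it can only be \<open>p\<close>.
\<close>

lemma of_nat_prime_neq_0:
  assumes "CARD('a::{field,finite}) = p ^ h" "prime p" "prime r" "r \<noteq> p"
  shows "(of_nat r :: 'a) \<noteq> 0"
proof
  assume "(of_nat r :: 'a) = 0"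
  then have "CHAR('a) dvd r"
    by (simp add: of_nat_eq_0_iff_char_dvd)
  then have "CHAR('a) = r"
    using assms(3) CHAR_not_1 by (metis One_nat_def prime_nat_iff)
  then have "r dvd p ^ h"
    using CHAR_dvd_CARD[where 'a = 'a] assms(1) by simp
  then show False
    using assms(2-4) by (metis prime_dvd_power primes_dvd_imp_eq)
qed

theorem theorem1p4:
  fixes p h q :: nat
  assumes "prime p" and "p > 3" and "h \<ge> 1" and "q = p ^ h"
    and "CARD('a::{field,finite}) = q"
  shows "\<exists>\<omega> :: 'a poly set. 0 \<notin> \<omega> \<and> B2_sequence 2 \<omega> \<and> asymptotic_basis 3 \<omega>"
proof -
  have card: "CARD('a) = p ^ h"
    using assms(4,5) by simp
  have char: "(2::'a) \<noteq> 0" "(3::'a) \<noteq> 0"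
    using of_nat_prime_neq_0[OF card assms(1), of 2] of_nat_prime_neq_0[OF card assms(1), of 3]
      assms(2) by simp_all
  obtain f :: "'a poly \<Rightarrow> nat" where f: "inj f" "\<And>n. degree n < f n"
    using ex_inj_above_degree by blast
  show ?thesis
    using powers_and_complements_nonzero[OF f(2)] powers_and_complements_B2[OF char f]
      powers_and_complements_basis by blast
qed

end
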